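(* Let $n \geq 1$ be an integer, let $M$ be a perfect matching of the complete bipartite graph $K_{n,n}$, and let $H = K_{n,n} - M$ be the graph obtained from $K_{n,n}$ by deleting the edges of $M$. Then for every positive integer $k$, \[ B(H; k) =\sum_{s=0}^{n} \binom{n}{s} \sum_{j=0}^{k - n + s} S(s,j)\, S(s,\,k - n + s - j), \] where the inner sum is zero if $k - n + s < 0$.
   Context: For a finite simple graph $G=(V,E)$, a proper partition of $G$ is a partition of $V$ into non-empty, pairwise disjoint subsets (parts), each of which is an independent set of $G$ (no two vertices in the same part are adjacent). The graphical Stirling number $B(G;k)$ is the number of proper partitions of $G$ into exactly $k$ parts. $S(m,j)$ denotes the Stirling number of the second kind, i.e. the number of partitions of an $m$-element set into $j$ non-empty subsets, with the usual conventions $S(0,0)=1$, $S(m,0)=0$ for $m\ge 1$, and $S(m,j)=0$ for $j>m$. Deleting $M$ removes only edges, so $H$ has the same $2n$ vertices as $K_{n,n}$. *)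

theory Defs
  imports "HOL-Library.Disjoint_Sets" "HOL-Combinatorics.Stirling"
begin

section \<open>Finite simple graphs\<close>

record 'a ugraph =
  verts :: "'a set"
  edges :: "'a set set"

definition fin_simple_graph :: "'a ugraph \<Rightarrow> bool" where
  "fin_simple_graph G \<longleftrightarrow> finite (verts G) \<and> (\<forall>e\<in>edges G. e \<subseteq> verts G \<and> card e = 2)"

definition delete_edges :: "'a ugraph \<Rightarrow> 'a set set \<Rightarrow> 'a ugraph" where
  "delete_edges G M = \<lparr>verts = verts G, edges = edges G - M\<rparr>"

definition complete_bipartite :: "nat \<Rightarrow> nat \<Rightarrow> 'a ugraph \<Rightarrow> bool" where
  "complete_bipartite m n G \<longleftrightarrow>
     (\<exists>A B. finite A \<and> finite B \<and> card A = m \<and> card B = n \<and> A \<inter> B = {} \<and>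
        verts G = A \<union> B \<and> edges G = {{a, b} | a b. a \<in> A \<and> b \<in> B})"

definition perfect_matching :: "'a ugraph \<Rightarrow> 'a set set \<Rightarrow> bool" where
  "perfect_matching G M \<longleftrightarrow> M \<subseteq> edges G \<and> (\<forall>v\<in>verts G. \<exists>!e. e \<in> M \<and> v \<in> e)"

lemma fin_simple_graph_delete_edges:
  "fin_simple_graph G \<Longrightarrow> fin_simple_graph (delete_edges G M)"
  by (auto simp: fin_simple_graph_def delete_edges_def)

lemma complete_bipartite_imp_fin_simple_graph:
  assumes "complete_bipartite m n G"
  shows "fin_simple_graph G"
proof -
  obtain A B where *: "finite A" "finite B" "A \<inter> B = {}" "verts G = A \<union> B"
      "edges G = {{a, b} | a b. a \<in> A \<and> b \<in> B}"
    using assms by (auto simp: complete_bipartite_def)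
  have "a \<noteq> b" if "a \<in> A" "b \<in> B" for a b
    using that *(3) by auto
  then show ?thesis
    using * by (auto simp: fin_simple_graph_def)
qed


section \<open>Proper partitions and graphical Stirling numbers\<close>

definition independent_set :: "'a ugraph \<Rightarrow> 'a set \<Rightarrow> bool" where
  "independent_set G S \<longleftrightarrow> S \<subseteq> verts G \<and> (\<forall>u\<in>S. \<forall>v\<in>S. {u, v} \<notin> edges G)"

definition proper_partition :: "'a ugraph \<Rightarrow> 'a set set \<Rightarrow> bool" where
  "proper_partition G P \<longleftrightarrow> partition_on (verts G) P \<and> (\<forall>S\<in>P. independent_set G S)"

definition graph_Stirling :: "'a ugraph \<Rightarrow> nat \<Rightarrow> nat" where
  "graph_Stirling G k = card {P. proper_partition G P \<and> card P = k}"


section \<open>Stirling numbers of the second kind count set partitions\<close>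

text \<open>
  The library defines \<^const>\<open>Stirling\<close> by its recurrence; the following shows that
  it is the number of partitions of a finite set into a given number of parts.
\<close>

lemma card_partitions_insert:
  assumes fin: "finite A" and x: "x \<notin> A"
  shows "card {P. partition_on (insert x A) P \<and> card P = Suc k} =
    Suc k * card {P. partition_on A P \<and> card P = Suc k} + card {P. partition_on A P \<and> card P = k}"
proof -
  define X where "X j = {P. partition_on A P \<and> card P = j}" for j
  define f where "f = (\<lambda>(Q, q). insert (insert x q) (Q - {q}))"
  define Y where "Y = Sigma (X (Suc k)) (\<lambda>Q. Q)"
  have finX: "finite (X j)" for j
    unfolding X_def by (rule finite_subset[OF _ finitely_many_partition_on[OF fin]]) auto
  have finQ: "finite Q" if "Q \<in> X j" for Q j
    using that finite_elements[OF fin] by (auto simp: X_def)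
  have notin: "x \<notin> q" if "Q \<in> X j" "q \<in> Q" for Q j q
    using that x by (auto simp: X_def partition_on_def)
  have inj1: "inj_on (insert {x}) (X k)"
  proof (rule inj_onI)
    fix P Q assume "P \<in> X k" "Q \<in> X k" "insert {x} P = insert {x} Q"
    moreover have "{x} \<notin> P" "{x} \<notin> Q" using calculation notin by blast+
    ultimately show "P = Q" by (metis insert_ident)
  qed
  have inj2: "inj_on f Y"
  proof (rule inj_onI, clarsimp simp: Y_def f_def)
    fix P p Q q
    assume P: "P \<in> X (Suc k)" "p \<in> P" and Q: "Q \<in> X (Suc k)" "q \<in> Q"
      and eq: "insert (insert x p) (P - {p}) = insert (insert x q) (Q - {q})"
    have px: "\<And>r. r \<in> P \<Longrightarrow> x \<notin> r" and qx: "\<And>r. r \<in> Q \<Longrightarrow> x \<notin> r"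
      using notin P Q by blast+
    have "insert x p \<in> insert (insert x q) (Q - {q})" using eq by blast
    then have "insert x p = insert x q" using qx by blast
    then have pq: "p = q" using px[OF P(2)] qx[OF Q(2)] by (metis insert_ident)
    moreover have "insert x p \<notin> P - {p}" "insert x p \<notin> Q - {q}" using px qx by blast+
    ultimately have "P - {p} = Q - {q}" using eq by (metis insert_ident)
    then show "P = Q \<and> p = q" using pq P Q by blast
  qed
  have sub1: "partition_on (insert x A) (insert {x} Q) \<and> card (insert {x} Q) = Suc k"
    if Q: "Q \<in> X k" for Q
  proof -
    have "\<Union>Q = A" using Q by (auto simp: X_def partition_on_def)
    then have "disjnt {x} (\<Union>Q)" using x by auto
    moreover have "insert x A - {x} = A" using x by auto
    ultimately have "partition_on (insert x A) (insert {x} Q)"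
      using Q by (subst partition_on_insert) (auto simp: X_def)
    moreover have "{x} \<notin> Q" using notin[OF Q] by blast
    ultimately show ?thesis using finQ[OF Q] Q by (simp add: X_def)
  qed
  have sub2: "partition_on (insert x A) (f (Q, q)) \<and> card (f (Q, q)) = Suc k"
    if Q: "Q \<in> X (Suc k)" "q \<in> Q" for Q q
  proof -
    have part: "partition_on A Q" and c: "card Q = Suc k" using Q by (auto simp: X_def)
    have U: "\<Union>Q = A" using part by (auto simp: partition_on_def)
    have dj: "disjnt q (\<Union>(Q - {q}))"
      using part Q(2) by (auto simp: partition_on_def disjoint_def disjnt_def)
    have "partition_on A (insert q (Q - {q}))" using part Q(2) by (simp add: insert_absorb)
    then have pq: "partition_on (A - q) (Q - {q})" "q \<subseteq> A"
      using partition_on_insert[OF dj] by blast+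
    have "disjnt (insert x q) (\<Union>(Q - {q}))" using dj x U by auto
    moreover have "insert x A - insert x q = A - q" using x by auto
    ultimately have "partition_on (insert x A) (insert (insert x q) (Q - {q}))"
      using pq by (subst partition_on_insert) auto
    moreover have "insert x q \<notin> Q - {q}" using notin[OF Q(1)] by blast
    ultimately show ?thesis using finQ[OF Q(1)] Q(2) c by (simp add: f_def)
  qed
  have cover: "P \<in> insert {x} ` X k \<union> f ` Y"
    if P: "partition_on (insert x A) P" "card P = Suc k" for P
  proof -
    have finP: "finite P" using finite_elements[OF _ P(1)] fin by simp
    obtain p where p: "p \<in> P" "x \<in> p" using P(1) by (auto simp: partition_on_def)
    have dj: "disjnt p (\<Union>(P - {p}))"
      using P(1) p(1) by (auto simp: partition_on_def disjoint_def disjnt_def)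
    have "partition_on (insert x A) (insert p (P - {p}))" using P(1) p(1) by (simp add: insert_absorb)
    then have "partition_on (insert x A - p) (P - {p}) \<and> p \<subseteq> insert x A \<and> p \<noteq> {}"
      by (rule iffD1[OF partition_on_insert[OF dj]])
    then have pp: "partition_on (insert x A - p) (P - {p})" "p \<subseteq> insert x A"
      by simp_all
    show ?thesis
    proof (cases "p = {x}")
      case True
      then have "P - {p} \<in> X k"
        using pp x P(2) p(1) finP by (simp add: X_def)
      moreover have "P = insert {x} (P - {p})" using True p(1) by blast
      ultimately show ?thesis by blast
    next
      case False
      define q where "q = p - {x}"
      have q: "q \<noteq> {}" "q \<subseteq> A" "x \<notin> q" "p = insert x q"
        using False p pp x by (auto simp: q_def)
      have AQ: "insert x A - p = A - q" using q x by auto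
      have dq: "disjnt q (\<Union>(P - {p}))" using dj q(4) by auto
      have part: "partition_on A (insert q (P - {p}))"
        using pp q AQ by (subst partition_on_insert[OF dq]) auto
      have nq: "q \<notin> P - {p}" using dq q(1) by (auto simp: disjnt_def)
      have "card (insert q (P - {p})) = Suc k"
        using nq finP p(1) P(2) by simp
      with part have "(insert q (P - {p}), q) \<in> Y" by (simp add: Y_def X_def)
      moreover have "f (insert q (P - {p}), q) = P"
        using nq p(1) q(4) by (auto simp: f_def)
      ultimately show ?thesis by (metis UnI2 image_eqI)
    qed
  qed
  have "{P. partition_on (insert x A) P \<and> card P = Suc k} = insert {x} ` X k \<union> f ` Y" (is "?L = ?R")
  proof (rule subset_antisym)
    show "?L \<subseteq> ?R" using cover by (intro subsetI) (simp only: mem_Collect_eq)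
    have "insert {x} ` X k \<subseteq> ?L"
      by (rule image_subsetI) (use sub1 in \<open>simp only: mem_Collect_eq\<close>)
    moreover have "f Qq \<in> ?L" if "Qq \<in> Y" for Qq
      using that sub2[of "fst Qq" "snd Qq"] by (cases Qq) (simp add: Y_def)
    ultimately show "?R \<subseteq> ?L" by blast
  qed
  moreover have "insert {x} ` X k \<inter> f ` Y = {}"
  proof -
    have "{x} \<notin> f (Q, q)" if Q: "Q \<in> X (Suc k)" "q \<in> Q" for Q q
    proof -
      have "q \<noteq> {}" using Q by (auto simp: X_def partition_on_def)
      moreover have "x \<notin> q" using notin Q by blast
      moreover have "{x} \<notin> Q" using notin[OF Q(1)] by blast
      ultimately show ?thesis by (auto simp: f_def)
    qed
    then have "{x} \<notin> P" if "P \<in> f ` Y" for P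
      using that by (force simp: Y_def)
    then show ?thesis by blast
  qed
  moreover have finY: "finite Y" unfolding Y_def using finX finQ by auto
  moreover have "card Y = Suc k * card (X (Suc k))"
  proof -
    have "card Y = (\<Sum>Q\<in>X (Suc k). card Q)"
      unfolding Y_def using finX finQ by (intro card_SigmaI) auto
    also have "\<dots> = (\<Sum>Q\<in>X (Suc k). Suc k)" by (intro sum.cong) (auto simp: X_def)
    finally show ?thesis by simp
  qed
  ultimately show ?thesis
    using finX inj1 inj2 by (simp add: card_Un_disjoint card_image flip: X_def)
qed

theorem card_partition_on_eq_Stirling:
  assumes "finite A"
  shows "card {P. partition_on A P \<and> card P = k} = Stirling (card A) k"
  using assms
proof (induction A arbitrary: k rule: finite_induct)
  case empty
  have "{P :: 'a set set. partition_on {} P \<and> card P = k} = (if k = 0 then {{}} else {})"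
    by (auto simp: partition_on_empty)
  then show ?case by (cases k) (simp_all only: if_True if_False nat.distinct card.empty, simp_all)
next
  case (insert x A)
  show ?case
  proof (cases k)
    case 0
    have "card P \<noteq> 0" if "partition_on (insert x A) P" for P
      using that finite_elements[OF _ that] insert.hyps(1) by (auto simp: partition_on_def)
    then have "{P. partition_on (insert x A) P \<and> card P = k} = {}"
      using 0 by blast
    then have "card {P. partition_on (insert x A) P \<and> card P = k} = 0"
      by (simp only: card.empty)
    then show ?thesis using 0 insert.hyps by simp
  next
    case (Suc j)
    then show ?thesis
      using card_partitions_insert[OF insert.hyps(1,2)] insert by simp
  qed
qed

end

theory Submission
  imports Defs
begin

text \<open>
  Let \<open>A\<close> and \<open>B\<close> be the two sides of the complete bipartite graph. If an independent set of
  \<open>H\<close> contains \<open>a \<in> A\<close> and \<open>b \<in> B\<close>, then \<open>{a, b}\<close> is an edge of \<open>K\<^bsub>n,n\<^esub>\<close> that is missing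
  from \<open>H\<close>, so it lies in \<open>M\<close>. A vertex has only one partner in \<open>M\<close>; hence such a set is a single
  matching edge, and all other independent sets lie inside one side
  (\<open>independent_set_minus_matching_iff\<close>).

  A proper partition of \<open>H\<close> is therefore determined by the set \<open>N \<subseteq> M\<close> of matching edges
  occurring among its parts, together with a partition of the vertices that \<open>N\<close> leaves over into
  one-sided parts (\<open>card_partitions_prescribed_parts\<close>). The latter is a pair of arbitrary partitions
  of the two remaining sides, whose numbers of parts add up to \<open>k - |N|\<close>; these pairs
  are counted by a convolution of Stirling numbers (\<open>card_onesided_partitions\<close>).
  Each edge of \<open>N\<close> uses up one vertex of either side, so both remaining sides have
  \<open>s = n - |N|\<close> vertices. Grouping the sets \<open>N\<close> by \<open>s\<close> produces the binomial coefficients.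
\<close>

section \<open>Partitions into one-sided parts\<close>

lemma partition_on_Un:
  assumes "partition_on A P" "partition_on B Q" "A \<inter> B = {}"
  shows "partition_on (A \<union> B) (P \<union> Q)"
  using assms by (auto simp: partition_on_def intro: disjoint_union)

definition onesided_partitions :: "'a set \<Rightarrow> 'a set \<Rightarrow> nat \<Rightarrow> 'a set set set" where
  "onesided_partitions A B m =
     {P. partition_on (A \<union> B) P \<and> (\<forall>S\<in>P. S \<subseteq> A \<or> S \<subseteq> B) \<and> card P = m}"

text \<open>
  A partition with one-sided parts splits uniquely into its parts inside \<open>A\<close> and its parts
  inside \<open>B\<close>, because a non-empty part cannot lie in both.
\<close>

lemma card_onesided_partitions:
  assumes fin: "finite A" "finite B" and AB: "A \<inter> B = {}"
  shows "card (onesided_partitions A B m) =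
    (\<Sum>j=0..m. Stirling (card A) j * Stirling (card B) (m - j))"
proof -
  define X where "X j = {Q. partition_on A Q \<and> card Q = j}" for j
  define Y where "Y j = {R. partition_on B R \<and> card R = j}" for j
  define Z where "Z = (\<Union>j\<in>{0..m}. X j \<times> Y (m - j))"
  have finX: "finite (X j)" and finY: "finite (Y j)" for j
    using finitely_many_partition_on[OF fin(1)] finitely_many_partition_on[OF fin(2)]
    by (simp_all add: X_def Y_def)
  have cX: "card (X j) = Stirling (card A) j" and cY: "card (Y j) = Stirling (card B) j" for j
    unfolding X_def Y_def using fin by (simp_all only: card_partition_on_eq_Stirling)
  have recover: "{S \<in> Q \<union> R. S \<subseteq> A} = Q" "{S \<in> Q \<union> R. S \<subseteq> B} = R" "Q \<inter> R = {}"
    if "partition_on A Q" "partition_on B R" for Q R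
  proof -
    have sub: "\<And>S. S \<in> Q \<Longrightarrow> S \<noteq> {} \<and> S \<subseteq> A" "\<And>S. S \<in> R \<Longrightarrow> S \<noteq> {} \<and> S \<subseteq> B"
      using that by (auto simp: partition_on_def)
    have "\<not> S \<subseteq> B" if "S \<in> Q" for S using sub(1)[OF that] AB by blast
    moreover have "\<not> S \<subseteq> A" if "S \<in> R" for S using sub(2)[OF that] AB by blast
    ultimately show "{S \<in> Q \<union> R. S \<subseteq> A} = Q" "{S \<in> Q \<union> R. S \<subseteq> B} = R" "Q \<inter> R = {}"
      using sub by blast+
  qed
  have "bij_betw (\<lambda>(Q, R). Q \<union> R) Z (onesided_partitions A B m)"
  proof (rule bij_betwI[where g = "\<lambda>P. ({S \<in> P. S \<subseteq> A}, {S \<in> P. S \<subseteq> B})"])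
    show "(\<lambda>(Q, R). Q \<union> R) \<in> Z \<rightarrow> onesided_partitions A B m"
    proof safe
      fix Q R assume "(Q, R) \<in> Z"
      then have QR: "partition_on A Q" "partition_on B R" and c: "card Q + card R = m"
        by (auto simp: Z_def X_def Y_def)
      have "card (Q \<union> R) = m"
        using finite_elements[OF fin(1) QR(1)] finite_elements[OF fin(2) QR(2)] recover(3)[OF QR] c
        by (simp add: card_Un_disjoint)
      moreover have "S \<subseteq> A \<or> S \<subseteq> B" if "S \<in> Q \<union> R" for S
        using that QR by (auto simp: partition_on_def)
      ultimately show "Q \<union> R \<in> onesided_partitions A B m"
        using partition_on_Un[OF QR AB] by (simp add: onesided_partitions_def)
    qed
  next
    show "(\<lambda>P. ({S \<in> P. S \<subseteq> A}, {S \<in> P. S \<subseteq> B})) \<in> onesided_partitions A B m \<rightarrow> Z"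
    proof
      fix P assume "P \<in> onesided_partitions A B m"
      then have P: "partition_on (A \<union> B) P" "\<forall>S\<in>P. S \<subseteq> A \<or> S \<subseteq> B" "card P = m"
        by (auto simp: onesided_partitions_def)
      let ?Q = "{S \<in> P. S \<subseteq> A}" and ?R = "{S \<in> P. S \<subseteq> B}"
      have "\<Union>?Q = A" "\<Union>?R = B"
        using P(1,2) AB unfolding partition_on_def by blast+
      then have QR: "partition_on A ?Q" "partition_on B ?R"
        using P(1) by (auto simp: partition_on_def intro: pairwise_subset)
      have "card ?Q + card ?R = card (?Q \<union> ?R)"
        using recover(3)[OF QR] finite_elements[OF _ P(1)] fin by (simp add: card_Un_disjoint)
      also have "?Q \<union> ?R = P" using P(2) by blast
      finally have "card ?Q + card ?R = m" using P(3) by simp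
      then have "card ?Q \<in> {0..m}" "card ?R = m - card ?Q" by auto
      then show "(?Q, ?R) \<in> Z" using QR unfolding Z_def X_def Y_def by blast
    qed
  next
    fix QR assume "QR \<in> Z"
    then show "(\<lambda>P. ({S \<in> P. S \<subseteq> A}, {S \<in> P. S \<subseteq> B})) ((\<lambda>(Q, R). Q \<union> R) QR) = QR"
      using recover by (cases QR) (auto simp: Z_def X_def Y_def)
  next
    fix P assume "P \<in> onesided_partitions A B m"
    then show "(\<lambda>(Q, R). Q \<union> R) ({S \<in> P. S \<subseteq> A}, {S \<in> P. S \<subseteq> B}) = P"
      by (auto simp: onesided_partitions_def)
  qed
  then have "card (onesided_partitions A B m) = card Z"
    using bij_betw_same_card by metis
  also have "\<dots> = (\<Sum>j=0..m. card (X j \<times> Y (m - j)))"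
    unfolding Z_def by (rule card_UN_disjoint) (use finX finY in \<open>auto simp: X_def\<close>)
  finally show ?thesis by (simp add: card_cartesian_product cX cY)
qed


section \<open>Proper partitions in the presence of a matching\<close>

lemma Union_Diff_of_disjoint:
  assumes "disjoint P" "N \<subseteq> P"
  shows "\<Union>(P - N) = \<Union>P - \<Union>N"
proof -
  have "S \<inter> T = {}" if "S \<in> P - N" "T \<in> N" for S T
    using that assms by (auto dest: disjointD)
  then show ?thesis by blast
qed

text \<open>
  Fixing which members of a family \<open>M\<close> of two-sided sets occur as parts, the rest is a one-sided
  partition of the uncovered vertices; removing and adding the sets in \<open>N\<close> are inverse to each
  other, since no one-sided part can belong to \<open>M\<close>.
\<close>

lemma card_partitions_prescribed_parts:
  assumes fin: "finite A" "finite B"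
    and M: "partition_on (A \<union> B) M"
    and two: "\<And>e. e \<in> M \<Longrightarrow> \<not> e \<subseteq> A \<and> \<not> e \<subseteq> B"
    and N: "N \<subseteq> M"
  shows "card {P. partition_on (A \<union> B) P \<and> (\<forall>S\<in>P. S \<in> M \<or> S \<subseteq> A \<or> S \<subseteq> B)
              \<and> P \<inter> M = N \<and> card P = k}
    = (if k < card N then 0 else card (onesided_partitions (A - \<Union>N) (B - \<Union>N) (k - card N)))"
    (is "card ?X = _")
proof (cases "k < card N")
  case True
  have "card N \<le> card P" if "partition_on (A \<union> B) P" "P \<inter> M = N" for P
    using that finite_elements[OF _ that(1)] fin by (intro card_mono) auto
  then have "?X = {}" using True by fastforce
  then show ?thesis using True by (simp only: card.empty if_True)
next
  case False
  have finN: "finite N" using finite_elements[OF _ M] fin N finite_subset by blast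
  have U: "\<Union>N \<subseteq> A \<union> B" using M N by (auto simp: partition_on_def)
  have partN: "partition_on (\<Union>N) N"
    using M N by (auto simp: partition_on_def intro: pairwise_subset)
  have rest: "A - \<Union>N \<union> (B - \<Union>N) = A \<union> B - \<Union>N" by blast
  have "bij_betw (\<lambda>P. N \<union> P) (onesided_partitions (A - \<Union>N) (B - \<Union>N) (k - card N)) ?X"
  proof (rule bij_betwI[where g = "\<lambda>P. P - N"])
    show "(\<lambda>P. N \<union> P) \<in> onesided_partitions (A - \<Union>N) (B - \<Union>N) (k - card N) \<rightarrow> ?X"
    proof
      fix P assume "P \<in> onesided_partitions (A - \<Union>N) (B - \<Union>N) (k - card N)"
      then have P: "partition_on (A \<union> B - \<Union>N) P" "\<forall>S\<in>P. S \<subseteq> A \<or> S \<subseteq> B" "card P = k - card N"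
        unfolding onesided_partitions_def rest by blast+
      have "P \<inter> M = {}" using P(2) two by blast
      moreover have "partition_on (A \<union> B) (N \<union> P)"
        using partition_on_Un[OF partN P(1)] U by (simp add: Un_absorb1)
      moreover have "card (N \<union> P) = k"
        using \<open>P \<inter> M = {}\<close> N finN finite_elements[OF _ P(1)] fin P(3) False
        by (subst card_Un_disjoint) auto
      ultimately show "N \<union> P \<in> ?X" using P(2) N by blast
    qed
  next
    show "(\<lambda>P. P - N) \<in> ?X \<rightarrow> onesided_partitions (A - \<Union>N) (B - \<Union>N) (k - card N)"
    proof
      fix P assume "P \<in> ?X"
      then have P: "partition_on (A \<union> B) P" "\<forall>S\<in>P. S \<in> M \<or> S \<subseteq> A \<or> S \<subseteq> B" "P \<inter> M = N" "card P = k"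
        by blast+
      have part: "partition_on (A \<union> B - \<Union>N) (P - N)"
      proof -
        have "\<Union>(P - N) = A \<union> B - \<Union>N"
          using Union_Diff_of_disjoint[of P N] P(1,3) unfolding partition_on_def by blast
        then show ?thesis
          using P(1) by (auto simp: partition_on_def intro: pairwise_subset)
      qed
      have "S \<subseteq> A - \<Union>N \<or> S \<subseteq> B - \<Union>N" if "S \<in> P - N" for S
      proof -
        have "S \<subseteq> A \<or> S \<subseteq> B" using that P(2,3) by blast
        moreover have "S \<subseteq> A \<union> B - \<Union>N" using that part by (auto simp: partition_on_def)
        ultimately show ?thesis by blast
      qed
      moreover have "card (P - N) = k - card N"
        using P(3,4) finN by (subst card_Diff_subset) auto
      ultimately show "P - N \<in> onesided_partitions (A - \<Union>N) (B - \<Union>N) (k - card N)"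
        using part unfolding onesided_partitions_def rest by blast
    qed
  next
    fix P assume "P \<in> onesided_partitions (A - \<Union>N) (B - \<Union>N) (k - card N)"
    then have "\<forall>S\<in>P. S \<subseteq> A \<or> S \<subseteq> B" by (auto simp: onesided_partitions_def)
    then show "N \<union> P - N = P" using two N by blast
  next
    fix P assume "P \<in> ?X"
    then show "N \<union> (P - N) = P" by blast
  qed
  from bij_betw_same_card[OF this] show ?thesis using False by simp
qed

lemma perfect_matching_partition_on:
  assumes "perfect_matching G M" "fin_simple_graph G"
  shows "partition_on (verts G) M"
proof (rule partition_onI)
  have M: "e \<subseteq> verts G" "e \<noteq> {}" if "e \<in> M" for e
    using that assms unfolding perfect_matching_def fin_simple_graph_def by fastforce+
  show "\<Union>M = verts G" using M(1) assms(1) by (auto simp: perfect_matching_def)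
  show "disjnt p q" if "p \<in> M" "q \<in> M" "p \<noteq> q" for p q
    using that M(1) assms(1) unfolding perfect_matching_def disjnt_def by blast
  show "{} \<notin> M" using M(2) by blast
qed

text \<open>
  The forward direction uses that every cross pair of an independent set is a matching edge, and
  that a vertex lies on only one of these. Conversely, a matching edge has just one cross pair,
  and that edge has been deleted.
\<close>

lemma independent_set_minus_matching_iff:
  assumes AB: "A \<inter> B = {}"
    and G: "verts G = A \<union> B" "edges G = {{a, b} | a b. a \<in> A \<and> b \<in> B}"
    and M: "perfect_matching G M"
  shows "independent_set (delete_edges G M) S \<longleftrightarrow> S \<in> M \<or> S \<subseteq> A \<or> S \<subseteq> B"
proof
  assume "independent_set (delete_edges G M) S"
  then have S: "S \<subseteq> A \<union> B" "\<And>u v. u \<in> S \<Longrightarrow> v \<in> S \<Longrightarrow> {u, v} \<in> edges G \<Longrightarrow> {u, v} \<in> M"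
    by (auto simp: independent_set_def delete_edges_def G(1))
  show "S \<in> M \<or> S \<subseteq> A \<or> S \<subseteq> B"
  proof (cases "S \<subseteq> A \<or> S \<subseteq> B")
    case False
    then obtain a b where ab: "a \<in> S" "a \<in> A" "b \<in> S" "b \<in> B" using S(1) by blast
    have cross: "{x, y} \<in> M" if "x \<in> S" "y \<in> S" "x \<in> A" "y \<in> B" for x y
      using that S(2) G(2) by blast
    have unique: "e = e'" if "e \<in> M" "e' \<in> M" "v \<in> e" "v \<in> e'" "v \<in> A \<union> B" for e e' v
      using that M G(1) unfolding perfect_matching_def by blast
    \<comment> \<open>Any further vertex of \<open>S\<close> would be matched to \<open>a\<close> or to \<open>b\<close>.\<close>
    have "x \<in> {a, b}" if "x \<in> S" for x
    proof (cases "x \<in> A")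
      case True
      then have "{x, b} = {a, b}" using cross ab that by (intro unique[of _ _ b]) auto
      then show ?thesis by blast
    next
      case False
      then have "x \<in> B" using that S(1) by blast
      then have "{a, x} = {a, b}" using cross ab that by (intro unique[of _ _ a]) auto
      then show ?thesis by blast
    qed
    then have "S = {a, b}" using ab by blast
    then show ?thesis using cross ab by blast
  qed blast
next
  assume S: "S \<in> M \<or> S \<subseteq> A \<or> S \<subseteq> B"
  have "S \<subseteq> A \<union> B \<and> (\<forall>u\<in>S. \<forall>v\<in>S. {u, v} \<in> edges G \<longrightarrow> {u, v} \<in> M)"
  proof (cases "S \<in> M")
    case True
    then have "S \<in> edges G" using M by (auto simp: perfect_matching_def)
    then obtain a b where S: "S = {a, b}" "a \<in> A" "b \<in> B" using G(2) by auto
    have "{u, v} \<in> M" if uv: "u \<in> S" "v \<in> S" "{u, v} \<in> edges G" for u v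
    proof -
      obtain x y where "{u, v} = {x, y}" "x \<in> A" "y \<in> B" using uv(3) G(2) by auto
      then have "u \<noteq> v" using AB by auto
      then have "{u, v} = S" using uv(1,2) S(1) by auto
      then show ?thesis using True by simp
    qed
    then show ?thesis using S by blast
  next
    case False
    have "{u, v} \<notin> edges G" if uv: "u \<in> S" "v \<in> S" for u v
    proof
      assume "{u, v} \<in> edges G"
      then obtain x y where "{u, v} = {x, y}" "x \<in> A" "y \<in> B" using G(2) by auto
      then have "x \<in> S" "y \<in> S" using uv by (auto simp: doubleton_eq_iff)
      then show False using False S AB \<open>x \<in> A\<close> \<open>y \<in> B\<close> by blast
    qed
    then show ?thesis using False S by blast
  qed
  then show "independent_set (delete_edges G M) S"
    by (auto simp: independent_set_def delete_edges_def G(1))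
qed

text \<open>
  This computes how many vertices of one side a set of matching edges uses up, and, for the whole
  matching, that it has as many edges as a side has vertices.
\<close>

lemma card_Union_Int_transversal:
  assumes "finite N" "disjoint N" "\<And>e. e \<in> N \<Longrightarrow> card (e \<inter> A) = 1"
  shows "card (\<Union>N \<inter> A) = card N"
proof -
  have "card (\<Union>e\<in>N. e \<inter> A) = (\<Sum>e\<in>N. card (e \<inter> A))"
    using assms by (intro card_UN_disjoint) (auto simp: disjoint_def intro: card_ge_0_finite)
  also have "(\<Union>e\<in>N. e \<inter> A) = \<Union>N \<inter> A" by blast
  finally show ?thesis using assms(3) by simp
qed


section \<open>Counting\<close>

text \<open>
  The index \<open>s\<close> is the number of elements left out of \<open>N\<close>, so that below it becomes the number
  of vertices left over on either side.
\<close>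

lemma sum_Pow_by_card:
  fixes g :: "nat \<Rightarrow> nat"
  assumes "finite M"
  shows "(\<Sum>N\<in>Pow M. g (card N)) = (\<Sum>s=0..card M. (card M choose s) * g (card M - s))"
proof -
  have "(\<Sum>N\<in>Pow M. g (card N)) = (\<Sum>c=0..card M. \<Sum>N\<in>{N \<in> Pow M. card N = c}. g (card N))"
    using assms by (intro sum.group[symmetric]) (auto intro: card_mono)
  also have "\<dots> = (\<Sum>c=0..card M. (card M choose c) * g c)"
    by (intro sum.cong) (simp_all add: n_subsets[OF assms])
  also have "\<dots> = (\<Sum>s=0..card M. (card M choose s) * g (card M - s))"
    by (rule sum.reindex_bij_witness[of _ "\<lambda>s. card M - s" "\<lambda>s. card M - s"])
      (auto simp: binomial_symmetric[symmetric])
  finally show ?thesis .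
qed

theorem theorem2:
  fixes G H :: "'a ugraph" and M :: "'a set set" and n k :: nat
  assumes "n \<ge> 1"
    and "complete_bipartite n n G"
    and "perfect_matching G M"
    and "H = delete_edges G M"
    and "k \<ge> 1"
  shows "graph_Stirling H k =
    (\<Sum>s=0..n. (n choose s) *
      (if k + s < n then 0
       else (\<Sum>j=0..k + s - n. Stirling s j * Stirling s (k + s - n - j))))"
proof -
  obtain A B where fin: "finite A" "finite B" and card: "card A = n" "card B = n"
    and AB: "A \<inter> B = {}" and G: "verts G = A \<union> B" "edges G = {{a, b} | a b. a \<in> A \<and> b \<in> B}"
    using assms(2) unfolding complete_bipartite_def by (elim exE conjE) (rule that)
  have M: "partition_on (A \<union> B) M"
    using perfect_matching_partition_on[OF assms(3) complete_bipartite_imp_fin_simple_graph[OF assms(2)]]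
    by (simp add: G(1))
  have finM: "finite M" using finite_elements[OF _ M] fin by simp
  have edge: "\<exists>a b. e = {a, b} \<and> a \<in> A \<and> b \<in> B" if "e \<in> M" for e
    using that assms(3) G(2) unfolding perfect_matching_def by blast
  have two: "\<not> e \<subseteq> A \<and> \<not> e \<subseteq> B" if "e \<in> M" for e
    using edge[OF that] AB by blast
  have cross: "card (e \<inter> A) = 1 \<and> card (e \<inter> B) = 1" if "e \<in> M" for e
  proof -
    obtain a b where ab: "e = {a, b}" "a \<in> A" "b \<in> B" using edge[OF \<open>e \<in> M\<close>] by blast
    then have "e \<inter> A = {a}" "e \<inter> B = {b}" using AB by blast+
    then show ?thesis by simp
  qed
  have cover: "card (\<Union>N \<inter> A) = card N \<and> card (\<Union>N \<inter> B) = card N" if "N \<subseteq> M" for N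
  proof -
    have "finite N" "disjoint N"
      using that finM M finite_subset by (auto simp: partition_on_def intro: pairwise_subset)
    then show ?thesis using cross that by (auto intro!: card_Union_Int_transversal)
  qed
  have "\<Union>M \<inter> A = A" using M by (auto simp: partition_on_def)
  then have cardM: "card M = n" using cover[of M] card by simp
  have left: "card (A - \<Union>N) = n - card N" "card (B - \<Union>N) = n - card N" if "N \<subseteq> M" for N
    using cover[OF that] card fin by (simp_all add: card_Diff_subset_Int Int_commute)

  define X where "X N = {P. partition_on (A \<union> B) P \<and> (\<forall>S\<in>P. S \<in> M \<or> S \<subseteq> A \<or> S \<subseteq> B)
              \<and> P \<inter> M = N \<and> card P = k}" for N
  define g where "g c = (if k < c then 0
    else \<Sum>j=0..k - c. Stirling (n - c) j * Stirling (n - c) (k - c - j))" for c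
  have cardX: "card (X N) = g (card N)" if "N \<in> Pow M" for N
  proof -
    have N: "N \<subseteq> M" using that by simp
    have "card (onesided_partitions (A - \<Union>N) (B - \<Union>N) m) =
        (\<Sum>j=0..m. Stirling (n - card N) j * Stirling (n - card N) (m - j))" for m
    proof -
      have "(A - \<Union>N) \<inter> (B - \<Union>N) = {}" using AB by blast
      then show ?thesis using fin by (subst card_onesided_partitions) (simp_all add: left[OF N])
    qed
    then show ?thesis
      unfolding X_def g_def by (simp only: card_partitions_prescribed_parts[OF fin M two N])
  qed
  have "proper_partition H P \<longleftrightarrow>
      partition_on (A \<union> B) P \<and> (\<forall>S\<in>P. S \<in> M \<or> S \<subseteq> A \<or> S \<subseteq> B)" for P
    using independent_set_minus_matching_iff[OF AB G assms(3)]
    by (simp add: proper_partition_def assms(4) delete_edges_def G(1))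
  then have "graph_Stirling H k = card (\<Union>N\<in>Pow M. X N)"
    unfolding graph_Stirling_def X_def by (intro arg_cong[where f = card]) blast
  also have "\<dots> = (\<Sum>N\<in>Pow M. card (X N))"
  proof (rule card_UN_disjoint)
    have "finite {P. partition_on (A \<union> B) P}" using fin by (intro finitely_many_partition_on) simp
    then show "\<forall>N\<in>Pow M. finite (X N)"
      unfolding X_def by (auto elim: rev_finite_subset)
  qed (use finM in \<open>auto simp: X_def\<close>)
  also have "\<dots> = (\<Sum>N\<in>Pow M. g (card N))" using cardX by simp
  also have "\<dots> = (\<Sum>s=0..n. (n choose s) * g (n - s))"
    using sum_Pow_by_card[OF finM, of g] cardM by simp
  also have "\<dots> = (\<Sum>s=0..n. (n choose s) *
      (if k + s < n then 0
       else (\<Sum>j=0..k + s - n. Stirling s j * Stirling s (k + s - n - j))))"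
  proof (rule sum.cong[OF refl])
    fix s assume "s \<in> {0..n}"
    then have "n - (n - s) = s" "k < n - s \<longleftrightarrow> k + s < n" "k - (n - s) = k + s - n" by auto
    then show "(n choose s) * g (n - s) = (n choose s) *
      (if k + s < n then 0
       else (\<Sum>j=0..k + s - n. Stirling s j * Stirling s (k + s - n - j)))"
      by (simp only: g_def)
  qed
  finally show ?thesis .
qed

end
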